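(* Assume $\mathcal F$ fails the weak amalgamation property. Then Eve has a winning strategy in the game $\mathrm{BM}(\mathcal F, W^{\hookleftarrow})$ for every $W \in \sigma\mathcal F$.
   Context: Fix a countable first-order signature. $\mathcal F$ is a class, closed under isomorphisms, of countable finitely generated structures in this signature. $X \leq Y$ means that $X$ is a substructure of $Y$. $\sigma\mathcal F$ is the class of all structures of the form $\bigcup_{n\in\omega} X_n$, where $X_0 \leq X_1 \leq X_2 \leq \cdots$ is a chain of structures from $\mathcal F$. The game $\mathrm{BM}(\mathcal F, W^{\hookleftarrow})$: two players, Eve and Odd, alternately build a chain $A_0 \leq A_1 \leq A_2 \leq \cdots$ of structures from $\mathcal F$. Eve starts by choosing $A_0 \in \mathcal F$; Odd responds with $A_1 \in \mathcal F$, $A_1 \geq A_0$; Eve responds with $A_2 \in \mathcal F$, $A_2 \geq A_1$; and so on (Eve chooses $A_n$ for even $n$, Odd for odd $n$). Odd wins if $A_\infty = \bigcup_{n\in\omega} A_n$ embeds into $W$; otherwise Eve wins. A strategy prescribes a player's move as a function of the finite sequence of previous moves; it is winning if the player wins every play in which it is followed. $\mathcal F$ has the weak amalgamation property (WAP) if for every $Z \in \mathcal F$ there is $Z' \in \mathcal F$ with $Z \leq Z'$ such that for all embeddings $f\colon Z' \to X$, $g\colon Z' \to Y$ with $X, Y \in \mathcal F$ there exist $V \in \mathcal F$ and embeddings $f'\colon X \to V$, $g'\colon Y \to V$ satisfying $f'\circ f \restriction Z = g' \circ g\restriction Z$. *)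

theory Defs
  imports "HOL-Library.Countable_Set" "HOL-Library.FuncSet"
begin

text \<open>A first-order signature; constants are function symbols of arity 0. The symbols form
  sets rather than whole types, so that either kind of symbol may be absent.\<close>

record ('f, 'r) signature =
  fun_syms :: "'f set"
  rel_syms :: "'r set"
  fun_arity :: "'f \<Rightarrow> nat"
  rel_arity :: "'r \<Rightarrow> nat"

definition countable_signature :: "('f, 'r) signature \<Rightarrow> bool" where
  "countable_signature S \<longleftrightarrow> countable (fun_syms S) \<and> countable (rel_syms S)"

record ('a, 'f, 'r) fo_structure =
  carrier :: "'a set"
  fun_of :: "'f \<Rightarrow> 'a list \<Rightarrow> 'a"
  rel_of :: "'r \<Rightarrow> 'a list set"

definition tuples :: "'a set \<Rightarrow> nat \<Rightarrow> 'a list set" where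
  "tuples C k = {xs. set xs \<subseteq> C \<and> length xs = k}"

text \<open>Interpretations are required to be extensional (no information outside the carrier and the
  signature), so that equality of structures in HOL is the mathematical equality. An empty carrier
  is not excluded here; a class of structures may exclude it.\<close>

definition is_structure :: "('f, 'r) signature \<Rightarrow> ('a, 'f, 'r) fo_structure \<Rightarrow> bool" where
  "is_structure S X \<longleftrightarrow>
     fun_of X \<in> (\<Pi>\<^sub>E f\<in>fun_syms S. tuples (carrier X) (fun_arity S f) \<rightarrow>\<^sub>E carrier X) \<and>
     (\<forall>r\<in>rel_syms S. rel_of X r \<subseteq> tuples (carrier X) (rel_arity S r)) \<and>
     (\<forall>r. r \<notin> rel_syms S \<longrightarrow> rel_of X r = {})"

definition substructure ::
  "('f, 'r) signature \<Rightarrow> ('a, 'f, 'r) fo_structure \<Rightarrow> ('a, 'f, 'r) fo_structure \<Rightarrow> bool" where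
  "substructure S X Y \<longleftrightarrow>
     carrier X \<subseteq> carrier Y \<and>
     (\<forall>f\<in>fun_syms S. \<forall>xs\<in>tuples (carrier X) (fun_arity S f). fun_of X f xs = fun_of Y f xs) \<and>
     (\<forall>r\<in>rel_syms S. \<forall>xs\<in>tuples (carrier X) (rel_arity S r). xs \<in> rel_of X r \<longleftrightarrow> xs \<in> rel_of Y r)"

definition embedding ::
  "('f, 'r) signature \<Rightarrow> ('a \<Rightarrow> 'b) \<Rightarrow> ('a, 'f, 'r) fo_structure \<Rightarrow> ('b, 'f, 'r) fo_structure \<Rightarrow> bool" where
  "embedding S h X Y \<longleftrightarrow>
     h ` carrier X \<subseteq> carrier Y \<and> inj_on h (carrier X) \<and>
     (\<forall>f\<in>fun_syms S. \<forall>xs\<in>tuples (carrier X) (fun_arity S f).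
        h (fun_of X f xs) = fun_of Y f (map h xs)) \<and>
     (\<forall>r\<in>rel_syms S. \<forall>xs\<in>tuples (carrier X) (rel_arity S r).
        xs \<in> rel_of X r \<longleftrightarrow> map h xs \<in> rel_of Y r)"

definition embeds ::
  "('f, 'r) signature \<Rightarrow> ('a, 'f, 'r) fo_structure \<Rightarrow> ('b, 'f, 'r) fo_structure \<Rightarrow> bool" where
  "embeds S X Y \<longleftrightarrow> (\<exists>h. embedding S h X Y)"

definition isomorphic ::
  "('f, 'r) signature \<Rightarrow> ('a, 'f, 'r) fo_structure \<Rightarrow> ('b, 'f, 'r) fo_structure \<Rightarrow> bool" where
  "isomorphic S X Y \<longleftrightarrow> (\<exists>h. embedding S h X Y \<and> h ` carrier X = carrier Y)"

inductive_set generated ::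
  "('f, 'r) signature \<Rightarrow> ('a, 'f, 'r) fo_structure \<Rightarrow> 'a set \<Rightarrow> 'a set"
  for S :: "('f, 'r) signature" and X :: "('a, 'f, 'r) fo_structure" and G :: "'a set" where
  base: "x \<in> G \<Longrightarrow> x \<in> generated S X G"
| app: "f \<in> fun_syms S \<Longrightarrow> length xs = fun_arity S f \<Longrightarrow> \<forall>x\<in>set xs. x \<in> generated S X G \<Longrightarrow>
    fun_of X f xs \<in> generated S X G"

definition finitely_generated :: "('f, 'r) signature \<Rightarrow> ('a, 'f, 'r) fo_structure \<Rightarrow> bool" where
  "finitely_generated S X \<longleftrightarrow>
     (\<exists>G. finite G \<and> G \<subseteq> carrier X \<and> generated S X G = carrier X)"

text \<open>Classes of structures are sets of structures whose elements are drawn from one type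
  \<open>'a\<close>. For an uncountable \<open>'a\<close> this is no restriction on classes of countable
  structures closed under isomorphisms: every countable structure has a copy in \<open>'a\<close>, and
  whenever a countable structure over \<open>'a\<close> embeds into another countable structure, the latter
  has a copy over \<open>'a\<close> which extends the former. Over a countable type a move could use up all
  elements and leave no proper extensions.\<close>

definition fg_class :: "('f, 'r) signature \<Rightarrow> ('a, 'f, 'r) fo_structure set \<Rightarrow> bool" where
  "fg_class S \<F> \<longleftrightarrow>
     (\<forall>X\<in>\<F>. is_structure S X \<and> countable (carrier X) \<and> finitely_generated S X) \<and>
     (\<forall>X\<in>\<F>. \<forall>Y. is_structure S Y \<and> isomorphic S X Y \<longrightarrow> Y \<in> \<F>)"

definition chain_in ::
  "('f, 'r) signature \<Rightarrow> ('a, 'f, 'r) fo_structure set \<Rightarrow> (nat \<Rightarrow> ('a, 'f, 'r) fo_structure) \<Rightarrow> bool" where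
  "chain_in S \<F> X \<longleftrightarrow> (\<forall>n. X n \<in> \<F> \<and> substructure S (X n) (X (Suc n)))"

text \<open>The union of a chain: a function symbol is evaluated in the first member of the chain that
  contains all the arguments.\<close>

definition chain_union ::
  "('f, 'r) signature \<Rightarrow> (nat \<Rightarrow> ('a, 'f, 'r) fo_structure) \<Rightarrow> ('a, 'f, 'r) fo_structure" where
  "chain_union S X =
     \<lparr>carrier = (\<Union>n. carrier (X n)),
      fun_of = (\<lambda>f\<in>fun_syms S. \<lambda>xs\<in>tuples (\<Union>n. carrier (X n)) (fun_arity S f).
        fun_of (X (LEAST n. set xs \<subseteq> carrier (X n))) f xs),
      rel_of = (\<lambda>r. \<Union>n. rel_of (X n) r)\<rparr>"

definition sigma_class ::
  "('f, 'r) signature \<Rightarrow> ('a, 'f, 'r) fo_structure set \<Rightarrow> ('a, 'f, 'r) fo_structure set" where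
  "sigma_class S \<F> = {chain_union S X | X. chain_in S \<F> X}"

definition weak_amalgamation ::
  "('f, 'r) signature \<Rightarrow> ('a, 'f, 'r) fo_structure set \<Rightarrow> bool" where
  "weak_amalgamation S \<F> \<longleftrightarrow>
     (\<forall>Z\<in>\<F>. \<exists>Z'\<in>\<F>. substructure S Z Z' \<and>
       (\<forall>X\<in>\<F>. \<forall>Y\<in>\<F>. \<forall>f g. embedding S f Z' X \<and> embedding S g Z' Y \<longrightarrow>
         (\<exists>V\<in>\<F>. \<exists>f' g'. embedding S f' X V \<and> embedding S g' Y V \<and>
           restrict (f' \<circ> f) (carrier Z) = restrict (g' \<circ> g) (carrier Z))))"

text \<open>The Banach--Mazur game. A position is the list of the moves made so far, oldest first; Eve
  is to move exactly at the positions of even length. An infinite play is a chain.\<close>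

definition position ::
  "('f, 'r) signature \<Rightarrow> ('a, 'f, 'r) fo_structure set \<Rightarrow> ('a, 'f, 'r) fo_structure list \<Rightarrow> bool" where
  "position S \<F> p \<longleftrightarrow> set p \<subseteq> \<F> \<and> successively (substructure S) p"

definition eve_strategy ::
  "('f, 'r) signature \<Rightarrow> ('a, 'f, 'r) fo_structure set \<Rightarrow>
   (('a, 'f, 'r) fo_structure list \<Rightarrow> ('a, 'f, 'r) fo_structure) \<Rightarrow> bool" where
  "eve_strategy S \<F> s \<longleftrightarrow>
     (\<forall>p. position S \<F> p \<and> even (length p) \<longrightarrow> position S \<F> (p @ [s p]))"

definition eve_follows ::
  "(('a, 'f, 'r) fo_structure list \<Rightarrow> ('a, 'f, 'r) fo_structure) \<Rightarrow>
   (nat \<Rightarrow> ('a, 'f, 'r) fo_structure) \<Rightarrow> bool" where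
  "eve_follows s A \<longleftrightarrow> (\<forall>n. even n \<longrightarrow> A n = s (map A [0..<n]))"

definition odd_wins ::
  "('f, 'r) signature \<Rightarrow> ('a, 'f, 'r) fo_structure \<Rightarrow> (nat \<Rightarrow> ('a, 'f, 'r) fo_structure) \<Rightarrow> bool" where
  "odd_wins S W A \<longleftrightarrow> embeds S (chain_union S A) W"

definition eve_winning_strategy ::
  "('f, 'r) signature \<Rightarrow> ('a, 'f, 'r) fo_structure set \<Rightarrow> ('a, 'f, 'r) fo_structure \<Rightarrow>
   (('a, 'f, 'r) fo_structure list \<Rightarrow> ('a, 'f, 'r) fo_structure) \<Rightarrow> bool" where
  "eve_winning_strategy S \<F> W s \<longleftrightarrow>
     eve_strategy S \<F> s \<and>
     (\<forall>A. chain_in S \<F> A \<and> eve_follows s A \<longrightarrow> \<not> odd_wins S W A)"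

end

theory Submission
  imports Defs
begin

text \<open>Let \<open>Z\<close> witness the failure of weak amalgamation; Eve opens with \<open>Z\<close>. As \<open>Z\<close> is finitely
  generated and \<open>W\<close> is countable, there are only countably many embeddings \<open>e\<^sub>0, e\<^sub>1, \<dots>\<close> of \<open>Z\<close>
  into \<open>W\<close>. When Odd has moved to \<open>A \<ge> Z\<close>, there are two extensions of \<open>A\<close> in the class that cannot
  be amalgamated over \<open>Z\<close>. If \<open>e\<^sub>k\<close> extended to embeddings of both into \<open>W\<close>, then both images would
  lie in a single member of a chain with union \<open>W\<close>, which would be an amalgam. So Eve can move to an
  extension to which \<open>e\<^sub>k\<close> does not extend, and by treating all \<open>k\<close> in turn she prevents every
  embedding of the final union into \<open>W\<close>.\<close>

section \<open>Tuples, substructures and embeddings\<close>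

lemma tuples_mono: "C \<subseteq> D \<Longrightarrow> tuples C k \<subseteq> tuples D k"
  by (auto simp: tuples_def)

lemma map_in_tuples: "xs \<in> tuples C k \<Longrightarrow> h ` C \<subseteq> D \<Longrightarrow> map h xs \<in> tuples D k"
  by (auto simp: tuples_def)

lemma is_structure_fun_closed:
  "is_structure S X \<Longrightarrow> f \<in> fun_syms S \<Longrightarrow> xs \<in> tuples (carrier X) (fun_arity S f) \<Longrightarrow>
   fun_of X f xs \<in> carrier X"
  unfolding is_structure_def by (meson PiE_mem)

lemma is_structure_rel_tuples:
  "is_structure S X \<Longrightarrow> r \<in> rel_syms S \<Longrightarrow> xs \<in> rel_of X r \<Longrightarrow> xs \<in> tuples (carrier X) (rel_arity S r)"
  unfolding is_structure_def by blast

lemma substructure_refl: "substructure S X X"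
  by (simp add: substructure_def)

lemma substructure_trans:
  assumes "substructure S X Y" "substructure S Y Z"
  shows "substructure S X Z"
proof -
  have "carrier X \<subseteq> carrier Y"
    using assms(1) by (simp add: substructure_def)
  then have "\<And>k xs. xs \<in> tuples (carrier X) k \<Longrightarrow> xs \<in> tuples (carrier Y) k"
    using tuples_mono by blast
  with assms show ?thesis
    unfolding substructure_def by auto
qed

lemma embedding_substructure_left:
  assumes "substructure S X Y" "embedding S h Y Z"
  shows "embedding S h X Z"
proof -
  have sub: "carrier X \<subseteq> carrier Y"
    using assms(1) by (simp add: substructure_def)
  then have "\<And>k xs. xs \<in> tuples (carrier X) k \<Longrightarrow> xs \<in> tuples (carrier Y) k"
    using tuples_mono by blast
  moreover have "inj_on h (carrier X)" "h ` carrier X \<subseteq> carrier Z"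
    using assms(2) sub inj_on_subset unfolding embedding_def by blast+
  ultimately show ?thesis
    using assms sub unfolding substructure_def embedding_def by auto
qed

lemma embedding_substructure_right:
  assumes "substructure S V W" "embedding S h X W" "h ` carrier X \<subseteq> carrier V"
  shows "embedding S h X V"
proof -
  have "\<And>k xs. xs \<in> tuples (carrier X) k \<Longrightarrow> map h xs \<in> tuples (carrier V) k"
    using assms(3) map_in_tuples by blast
  with assms show ?thesis
    unfolding substructure_def embedding_def by auto
qed

lemma embedding_comp:
  assumes "embedding S f X Y" "embedding S g Y Z"
  shows "embedding S (g \<circ> f) X Z"
proof -
  have sub: "f ` carrier X \<subseteq> carrier Y"
    using assms(1) by (simp add: embedding_def)
  then have tup: "\<And>k xs. xs \<in> tuples (carrier X) k \<Longrightarrow> map f xs \<in> tuples (carrier Y) k"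
    using map_in_tuples by blast
  have "inj_on (g \<circ> f) (carrier X)"
    using assms inj_on_subset[OF _ sub, of g] unfolding embedding_def by (intro comp_inj_on) simp_all
  moreover have "(g \<circ> f) ` carrier X \<subseteq> carrier Z"
    using assms unfolding embedding_def by auto
  moreover have "(g \<circ> f) (fun_of X c xs) = fun_of Z c (map (g \<circ> f) xs)"
    if "c \<in> fun_syms S" "xs \<in> tuples (carrier X) (fun_arity S c)" for c xs
    using assms that tup[OF that(2)] unfolding embedding_def by simp
  moreover have "xs \<in> rel_of X r \<longleftrightarrow> map (g \<circ> f) xs \<in> rel_of Z r"
    if "r \<in> rel_syms S" "xs \<in> tuples (carrier X) (rel_arity S r)" for r xs
    using assms that tup[OF that(2)] unfolding embedding_def by simp
  ultimately show ?thesis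
    unfolding embedding_def by blast
qed

text \<open>This turns an embedding into a genuine inclusion once its target has been renamed by
  \<open>j\<close>: the embedding \<open>j \<circ> f\<close> acts as the identity on tuples over
  \<open>X\<close> and, as \<open>X\<close> is closed under its functions, on their values.\<close>

lemma substructure_if_comp_id:
  assumes f: "embedding S f X Y" and j: "embedding S j Y Z" and X: "is_structure S X"
    and id: "\<And>x. x \<in> carrier X \<Longrightarrow> j (f x) = x"
  shows "substructure S X Z"
proof -
  have emb: "embedding S (j \<circ> f) X Z"
    using f j by (rule embedding_comp)
  have "map (j \<circ> f) xs = xs" if "xs \<in> tuples (carrier X) k" for xs k
    using that id by (auto simp: tuples_def intro!: map_idI)
  moreover have "(j \<circ> f) (fun_of X g xs) = fun_of X g xs"
    if "g \<in> fun_syms S" "xs \<in> tuples (carrier X) (fun_arity S g)" for g xs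
    using is_structure_fun_closed[OF X that] id by simp
  moreover have "carrier X \<subseteq> carrier Z"
    using emb id unfolding embedding_def by force
  ultimately show ?thesis
    using emb unfolding embedding_def substructure_def by simp
qed

section \<open>Finite generation and the number of embeddings\<close>

lemma generated_subset_carrier:
  assumes "is_structure S X" "G \<subseteq> carrier X"
  shows "generated S X G \<subseteq> carrier X"
proof
  fix x assume "x \<in> generated S X G"
  then show "x \<in> carrier X"
    by (induction rule: generated.induct)
      (use assms in \<open>auto intro!: is_structure_fun_closed simp: tuples_def\<close>)
qed

text \<open>As \<open>V\<close> is closed under the functions of \<open>W\<close>, the elements that
  \<open>h\<close> sends into \<open>V\<close> contain the generators and are closed under the
  functions of \<open>X\<close>.\<close>

lemma embedding_generated_image:
  assumes X: "is_structure S X" "G \<subseteq> carrier X" "generated S X G = carrier X"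
    and h: "embedding S h X W"
    and V: "is_structure S V" "substructure S V W" "h ` G \<subseteq> carrier V"
  shows "h ` carrier X \<subseteq> carrier V"
proof -
  have "h x \<in> carrier V" if "x \<in> generated S X G" for x
    using that
  proof (induction rule: generated.induct)
    case (base x)
    then show ?case using V by blast
  next
    case (app f xs)
    have xs: "xs \<in> tuples (carrier X) (fun_arity S f)"
      using app X(3) by (auto simp: tuples_def)
    have hxs: "map h xs \<in> tuples (carrier V) (fun_arity S f)"
      using app by (auto simp: tuples_def)
    have "h (fun_of X f xs) = fun_of V f (map h xs)"
      using h V(2) xs hxs app.hyps unfolding embedding_def substructure_def by simp
    then show ?case
      using is_structure_fun_closed[OF V(1) app.hyps(1) hxs] by simp
  qed
  then show ?thesis using X(3) by blast
qed

text \<open>The elements on which \<open>h\<close> and \<open>k\<close> agree are closed under the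
  functions of \<open>X\<close>.\<close>

lemma embedding_eq_on_generators:
  assumes X: "is_structure S X" "generated S X G = carrier X"
    and h: "embedding S h X W" and k: "embedding S k X W"
    and eq: "\<And>x. x \<in> G \<Longrightarrow> h x = k x" and x: "x \<in> carrier X"
  shows "h x = k x"
proof -
  have "x \<in> generated S X G" using X x by simp
  then show ?thesis
  proof (induction rule: generated.induct)
    case (base x)
    then show ?case by (rule eq)
  next
    case (app f xs)
    have xs: "xs \<in> tuples (carrier X) (fun_arity S f)"
      using app X(2) by (auto simp: tuples_def)
    have "map h xs = map k xs"
      using app by auto
    moreover have "h (fun_of X f xs) = fun_of W f (map h xs)" "k (fun_of X f xs) = fun_of W f (map k xs)"
      using h k xs app.hyps unfolding embedding_def by blast+
    ultimately show ?case
      by metis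
  qed
qed

text \<open>An embedding is determined on the carrier by the list of its values at finitely many
  generators, and there are only countably many lists over \<open>carrier W\<close>. Restricting
  discards the arbitrary values that a total HOL function takes outside the carrier.\<close>

lemma countable_embeddings:
  assumes "is_structure S X" "finitely_generated S X" "countable (carrier W)"
  shows "countable {restrict h (carrier X) | h. embedding S h X W}" (is "countable ?E")
proof -
  obtain G where G: "finite G" "G \<subseteq> carrier X" "generated S X G = carrier X"
    using assms(2) unfolding finitely_generated_def by blast
  obtain gs where gs: "set gs = G"
    using finite_list[OF G(1)] by blast
  have inj: "inj_on (\<lambda>e. map e gs) ?E"
  proof (rule inj_onI)
    fix e e' assume "e \<in> ?E" "e' \<in> ?E" and eq: "map e gs = map e' gs"
    then obtain h h' where h: "e = restrict h (carrier X)" "embedding S h X W"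
      and h': "e' = restrict h' (carrier X)" "embedding S h' X W"
      by auto
    have "h x = h' x" if "x \<in> G" for x
    proof -
      have "e x = e' x"
        using eq that gs by simp
      then show ?thesis
        using h(1) h'(1) that G(2) by auto
    qed
    then have "h x = h' x" if "x \<in> carrier X" for x
      using embedding_eq_on_generators[OF assms(1) G(3) h(2) h'(2)] that by blast
    then show "e = e'"
      unfolding h(1) h'(1) by (rule restrict_ext)
  qed
  have img: "h ` carrier X \<subseteq> carrier W" if "embedding S h X W" for h
    using that by (simp add: embedding_def)
  have "(\<lambda>e. map e gs) ` ?E \<subseteq> lists (carrier W)"
    using G(2) gs img by (fastforce simp: image_subset_iff)
  then have "countable ((\<lambda>e. map e gs) ` ?E)"
    by (rule countable_subset) (rule countable_lists[OF assms(3)])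
  then show ?thesis
    using inj by (rule countable_image_inj_on)
qed

section \<open>Realizing embeddings as extensions\<close>

text \<open>For \<open>j\<close> injective on the carrier this is the isomorphic copy of
  \<open>X\<close> along \<open>j\<close>. Function symbols are restricted to the signature and to
  tuples over the new carrier, to meet the extensionality that \<open>is_structure\<close>
  demands.\<close>

definition image_structure ::
  "('f, 'r) signature \<Rightarrow> ('a \<Rightarrow> 'b) \<Rightarrow> ('a, 'f, 'r) fo_structure \<Rightarrow> ('b, 'f, 'r) fo_structure" where
  "image_structure S j X =
     \<lparr>carrier = j ` carrier X,
      fun_of = (\<lambda>f\<in>fun_syms S. \<lambda>xs\<in>tuples (j ` carrier X) (fun_arity S f).
        j (fun_of X f (map (inv_into (carrier X) j) xs))),
      rel_of = (\<lambda>r. map j ` rel_of X r)\<rparr>"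

lemma is_structure_image_structure:
  assumes "is_structure S X"
  shows "is_structure S (image_structure S j X)"
proof -
  have "map (inv_into (carrier X) j) xs \<in> tuples (carrier X) k" if "xs \<in> tuples (j ` carrier X) k" for xs k
    using that by (rule map_in_tuples) (auto intro: inv_into_into)
  then have "fun_of (image_structure S j X) \<in>
      (\<Pi>\<^sub>E f\<in>fun_syms S. tuples (j ` carrier X) (fun_arity S f) \<rightarrow>\<^sub>E j ` carrier X)"
    using is_structure_fun_closed[OF assms] unfolding image_structure_def by auto
  moreover have "map j xs \<in> tuples (j ` carrier X) (rel_arity S r)"
    if "r \<in> rel_syms S" "xs \<in> rel_of X r" for r xs
    using is_structure_rel_tuples[OF assms that] map_in_tuples by blast
  ultimately show ?thesis
    using assms unfolding is_structure_def by (auto simp: image_structure_def)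
qed

lemma embedding_image_structure:
  assumes X: "is_structure S X" and j: "inj_on j (carrier X)"
  shows "embedding S j X (image_structure S j X)"
proof -
  have "map j xs \<in> tuples (j ` carrier X) k" if "xs \<in> tuples (carrier X) k" for xs k
    using that map_in_tuples by blast
  moreover have "map (inv_into (carrier X) j \<circ> j) xs = xs" if "xs \<in> tuples (carrier X) k" for xs k
    using that j by (auto simp: tuples_def intro!: map_idI)
  moreover have "xs \<in> rel_of X r"
    if r: "r \<in> rel_syms S" and xs: "xs \<in> tuples (carrier X) (rel_arity S r)"
      and mem: "map j xs \<in> map j ` rel_of X r" for r xs
  proof -
    obtain ys where ys: "ys \<in> rel_of X r" "map j xs = map j ys"
      using mem by blast
    have "set xs \<union> set ys \<subseteq> carrier X"
      using xs is_structure_rel_tuples[OF X r ys(1)] by (auto simp: tuples_def)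
    then have "xs = ys"
      using ys(2) j inj_on_subset map_inj_on by blast
    then show ?thesis using ys by simp
  qed
  ultimately show ?thesis
    using j unfolding embedding_def by (auto simp: image_structure_def)
qed

text \<open>Here the uncountability of the element type is used: it leaves room outside \<open>carrier Z\<close> for a
  copy of the new elements.\<close>

lemma embedding_as_extension:
  fixes \<F> :: "('a, 'f, 'r) fo_structure set"
  assumes unc: "uncountable (UNIV :: 'a set)" and \<F>: "fg_class S \<F>"
    and Z: "Z \<in> \<F>" and X: "X \<in> \<F>" and f: "embedding S f Z X"
  obtains X' j where "X' \<in> \<F>" "substructure S Z X'" "embedding S j X X'"
    "\<forall>z\<in>carrier Z. j (f z) = z"
proof -
  have sZ: "is_structure S Z" "countable (carrier Z)" and sX: "is_structure S X" "countable (carrier X)"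
    using \<F> Z X unfolding fg_class_def by blast+
  have "infinite (- carrier Z)"
    using unc sZ(2) by (metis Compl_partition countable_Un countable_finite)
  then obtain u :: "nat \<Rightarrow> 'a" where u: "inj u" "range u \<subseteq> - carrier Z"
    using infinite_countable_subset by blast
  have injf: "inj_on f (carrier Z)"
    using f by (simp add: embedding_def)
  \<comment> \<open>Elements of the image of \<open>f\<close> are named back to their origins in
    \<open>Z\<close>; all others get fresh names from \<open>u\<close>, through an enumeration of
    the countable \<open>carrier X\<close>.\<close>
  define j where "j = (\<lambda>x. if x \<in> f ` carrier Z then inv_into (carrier Z) f x
    else u (to_nat_on (carrier X) x))"
  have jf: "j (f z) = z" if "z \<in> carrier Z" for z
    using that injf by (simp add: j_def)
  have new: "j x \<notin> carrier Z" if "x \<notin> f ` carrier Z" for x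
    using that u(2) by (auto simp: j_def)
  have "inj_on j (carrier X)"
  proof (rule inj_onI)
    fix x y assume xy: "x \<in> carrier X" "y \<in> carrier X" "j x = j y"
    show "x = y"
    \<comment> \<open>By \<open>jf\<close> and \<open>new\<close>, \<open>j x\<close> lies in
      \<open>carrier Z\<close> exactly when \<open>x\<close> lies in the image of \<open>f\<close>,
      so an old and a new element never collide.\<close>
    proof (cases "x \<in> f ` carrier Z \<or> y \<in> f ` carrier Z")
      case True
      then have "j x \<in> carrier Z"
        using xy(3) jf by auto
      then have "x \<in> f ` carrier Z" "y \<in> f ` carrier Z"
        using xy(3) new by metis+
      then show ?thesis using xy(3) jf by auto
    next
      case False
      then have "to_nat_on (carrier X) x = to_nat_on (carrier X) y"
        using xy(3) injD[OF u(1)] by (simp add: j_def)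
      then show ?thesis using xy sX(2) by simp
    qed
  qed
  then have emb: "embedding S j X (image_structure S j X)"
    by (rule embedding_image_structure[OF sX(1)])
  have "isomorphic S X (image_structure S j X)"
    using emb unfolding isomorphic_def by (auto simp: image_structure_def)
  then have "image_structure S j X \<in> \<F>"
    using \<F> X is_structure_image_structure[OF sX(1)] unfolding fg_class_def by blast
  moreover have "substructure S Z (image_structure S j X)"
    using substructure_if_comp_id[OF f emb sZ(1) jf] by blast
  ultimately show thesis
    using that emb jf by blast
qed

section \<open>Unions of chains\<close>

lemma chain_substructure_mono:
  assumes "chain_in S \<F> X" "m \<le> n"
  shows "substructure S (X m) (X n)"
  using assms(2)
proof (induction rule: dec_induct)
  case base
  show ?case by (rule substructure_refl)
next
  case (step n)
  then show ?case
    using assms(1) substructure_trans unfolding chain_in_def by blast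
qed

text \<open>The union takes function values and relation instances from members other than
  \<open>X n\<close>; any two members are comparable, which transfers these to
  \<open>X n\<close>.\<close>

lemma substructure_chain_union:
  assumes X: "chain_in S \<F> X" and str: "\<And>n. is_structure S (X n)"
  shows "substructure S (X n) (chain_union S X)"
proof -
  let ?U = "\<Union>n. carrier (X n)"
  have U: "tuples (carrier (X n)) k \<subseteq> tuples ?U k" for k
    by (rule tuples_mono) blast
  have "fun_of (X n) f xs = fun_of (chain_union S X) f xs"
    if f: "f \<in> fun_syms S" and xs: "xs \<in> tuples (carrier (X n)) (fun_arity S f)" for f xs
  proof -
    define m where "m = (LEAST m. set xs \<subseteq> carrier (X m))"
    have n: "set xs \<subseteq> carrier (X n)"
      using xs by (simp add: tuples_def)
    then have "set xs \<subseteq> carrier (X m)" and le: "m \<le> n"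
      unfolding m_def by (rule LeastI, rule Least_le)
    then have "xs \<in> tuples (carrier (X m)) (fun_arity S f)"
      using xs by (simp add: tuples_def)
    then have "fun_of (X m) f xs = fun_of (X n) f xs"
      using chain_substructure_mono[OF X le] f unfolding substructure_def by blast
    then show ?thesis
      using f xs U by (auto simp: chain_union_def m_def)
  qed
  moreover have "xs \<in> rel_of (X n) r \<longleftrightarrow> xs \<in> rel_of (chain_union S X) r"
    if r: "r \<in> rel_syms S" and xs: "xs \<in> tuples (carrier (X n)) (rel_arity S r)" for r xs
  proof -
    \<comment> \<open>The tuple lies over both \<open>X m\<close> and \<open>X n\<close>, over
      \<open>X m\<close> because relations of a structure contain only tuples over its carrier. So
      the inclusion between the two members applies in either direction.\<close>
    have "xs \<in> rel_of (X n) r" if m: "xs \<in> rel_of (X m) r" for m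
    proof (cases "m \<le> n")
      case True
      then show ?thesis
        using chain_substructure_mono[OF X] is_structure_rel_tuples[OF str r m] r m
        unfolding substructure_def by blast
    next
      case False
      then have "substructure S (X n) (X m)"
        using chain_substructure_mono[OF X] by simp
      then show ?thesis
        using xs r m unfolding substructure_def by blast
    qed
    then show ?thesis
      by (auto simp: chain_union_def)
  qed
  ultimately show ?thesis
    unfolding substructure_def by (auto simp: chain_union_def)
qed

lemma chain_union_absorbs_finite:
  assumes X: "chain_in S \<F> X" and G: "finite G" "G \<subseteq> carrier (chain_union S X)"
  obtains n where "G \<subseteq> carrier (X n)"
proof -
  have mono: "carrier (X m) \<subseteq> carrier (X n)" if "m \<le> n" for m n
    using chain_substructure_mono[OF X that] unfolding substructure_def by blast
  have "\<exists>n. G \<subseteq> carrier (X n)"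
    using G
  proof (induction rule: finite_induct)
    case empty
    show ?case by simp
  next
    case (insert x G)
    then obtain n where n: "G \<subseteq> carrier (X n)" by auto
    obtain m where "x \<in> carrier (X m)"
      using insert.prems by (auto simp: chain_union_def)
    then have "insert x G \<subseteq> carrier (X (max m n))"
      using n mono[of m "max m n"] mono[of n "max m n"] by auto
    then show ?case by blast
  qed
  then show thesis using that by blast
qed

text \<open>The images of two finite generating sets lie in one member of the chain, which is closed
  under the functions of the union and so contains both full images. A common \<open>n\<close> is
  what allows \<open>C n\<close> to serve as an amalgam.\<close>

lemma embeddings_into_chain_union_factor:
  assumes \<F>: "fg_class S \<F>" and C: "chain_in S \<F> C" and "X \<in> \<F>" "Y \<in> \<F>"
    and h: "embedding S h X (chain_union S C)" and k: "embedding S k Y (chain_union S C)"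
  obtains n where "embedding S h X (C n)" "embedding S k Y (C n)"
proof -
  have sX: "is_structure S X" "finitely_generated S X" and sY: "is_structure S Y" "finitely_generated S Y"
    and sC: "\<And>n. is_structure S (C n)"
    using assms unfolding fg_class_def chain_in_def by blast+
  obtain G where G: "finite G" "G \<subseteq> carrier X" "generated S X G = carrier X"
    using sX unfolding finitely_generated_def by blast
  obtain H where H: "finite H" "H \<subseteq> carrier Y" "generated S Y H = carrier Y"
    using sY unfolding finitely_generated_def by blast
  have "h ` G \<union> k ` H \<subseteq> carrier (chain_union S C)"
  proof -
    have "h ` carrier X \<subseteq> carrier (chain_union S C)" "k ` carrier Y \<subseteq> carrier (chain_union S C)"
      using h k by (simp_all add: embedding_def)
    then show ?thesis using G(2) H(2) by blast
  qed
  then obtain n where n: "h ` G \<union> k ` H \<subseteq> carrier (C n)"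
    using chain_union_absorbs_finite[OF C] G(1) H(1) by (metis finite_Un finite_imageI)
  have sub: "substructure S (C n) (chain_union S C)"
    by (rule substructure_chain_union[OF C sC])
  have "h ` carrier X \<subseteq> carrier (C n)" "k ` carrier Y \<subseteq> carrier (C n)"
    using embedding_generated_image[OF sX(1) G(2,3) h sC sub]
      embedding_generated_image[OF sY(1) H(2,3) k sC sub] n by auto
  then show thesis
    using that embedding_substructure_right[OF sub] h k by blast
qed

section \<open>Eve's moves and her strategy\<close>

text \<open>This supplies Eve's reply to a move \<open>A\<close>, with \<open>e\<close> the
  embedding of \<open>Z\<close> treated in that round. The failure of amalgamation is used with
  \<open>A\<close> in the role of \<open>Z'\<close>.\<close>

lemma extension_avoiding_partial_embedding:
  fixes \<F> :: "('a, 'f, 'r) fo_structure set"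
  assumes unc: "uncountable (UNIV :: 'a set)" and \<F>: "fg_class S \<F>" and C: "chain_in S \<F> C"
    and A: "A \<in> \<F>" "substructure S Z A"
    and fails: "\<not> (\<forall>X\<in>\<F>. \<forall>Y\<in>\<F>. \<forall>f g. embedding S f A X \<and> embedding S g A Y \<longrightarrow>
      (\<exists>V\<in>\<F>. \<exists>f' g'. embedding S f' X V \<and> embedding S g' Y V \<and>
         restrict (f' \<circ> f) (carrier Z) = restrict (g' \<circ> g) (carrier Z)))"
  shows "\<exists>B\<in>\<F>. substructure S A B \<and>
    \<not> (\<exists>h. embedding S h B (chain_union S C) \<and> restrict h (carrier Z) = e)"
proof (rule ccontr)
  assume "\<not> ?thesis"
  then have ext: "\<exists>h. embedding S h B (chain_union S C) \<and> restrict h (carrier Z) = e"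
    if "B \<in> \<F>" "substructure S A B" for B
    using that by blast
  obtain X Y f g where XY: "X \<in> \<F>" "Y \<in> \<F>" and f: "embedding S f A X" and g: "embedding S g A Y"
    and no: "\<And>V f' g'. V \<in> \<F> \<Longrightarrow> embedding S f' X V \<Longrightarrow> embedding S g' Y V \<Longrightarrow>
      restrict (f' \<circ> f) (carrier Z) \<noteq> restrict (g' \<circ> g) (carrier Z)"
    using fails by blast
  \<comment> \<open>\<open>X\<close> and \<open>Y\<close> contain \<open>A\<close> only up to the
    embeddings \<open>f\<close> and \<open>g\<close>, whereas \<open>ext\<close> speaks of
    superstructures of \<open>A\<close>; hence the renamed copies.\<close>
  obtain X' i where X': "X' \<in> \<F>" "substructure S A X'" and i: "embedding S i X X'"
    and "\<forall>z\<in>carrier A. i (f z) = z"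
    by (rule embedding_as_extension[OF unc \<F> A(1) XY(1) f])
  moreover obtain Y' j where Y': "Y' \<in> \<F>" "substructure S A Y'" and j: "embedding S j Y Y'"
    and "\<forall>z\<in>carrier A. j (g z) = z"
    by (rule embedding_as_extension[OF unc \<F> A(1) XY(2) g])
  ultimately have id: "i (f z) = z" "j (g z) = z" if "z \<in> carrier Z" for z
    using that A(2) unfolding substructure_def by blast+
  obtain h where h: "embedding S h X' (chain_union S C)" "restrict h (carrier Z) = e"
    using ext[OF X'] by blast
  obtain k where k: "embedding S k Y' (chain_union S C)" "restrict k (carrier Z) = e"
    using ext[OF Y'] by blast
  obtain n where n: "embedding S (h \<circ> i) X (C n)" "embedding S (k \<circ> j) Y (C n)"
    by (rule embeddings_into_chain_union_factor[OF \<F> C XY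
          embedding_comp[OF i h(1)] embedding_comp[OF j k(1)]])
  \<comment> \<open>As \<open>i \<circ> f\<close> and \<open>j \<circ> g\<close> fix
    \<open>Z\<close> pointwise, both composites restrict to \<open>e\<close> on \<open>Z\<close>. So
    \<open>C n\<close>, a member of the class, amalgamates \<open>X\<close> and \<open>Y\<close>
    over \<open>Z\<close>.\<close>
  have "restrict (h \<circ> i \<circ> f) (carrier Z) = restrict h (carrier Z)"
    "restrict (k \<circ> j \<circ> g) (carrier Z) = restrict k (carrier Z)"
    using id by (auto intro!: restrict_ext)
  then show False
    using no[OF _ n] h(2) k(2) C unfolding chain_in_def by simp
qed

theorem theorem6p1:
  fixes S :: "('f, 'r) signature"
    and \<F> :: "('a, 'f, 'r) fo_structure set"
  assumes "uncountable (UNIV :: 'a set)"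
    and "countable_signature S"
    and "fg_class S \<F>"
    and "\<not> weak_amalgamation S \<F>"
  shows "\<forall>W\<in>sigma_class S \<F>. \<exists>s. eve_winning_strategy S \<F> W s"
proof
  fix W assume "W \<in> sigma_class S \<F>"
  then obtain C where C: "chain_in S \<F> C" and W: "W = chain_union S C"
    unfolding sigma_class_def by blast
  have str: "is_structure S X" "countable (carrier X)" "finitely_generated S X" if "X \<in> \<F>" for X
    using assms(3) that unfolding fg_class_def by blast+
  have "countable (carrier W)"
    using C str(2) unfolding W chain_union_def chain_in_def by auto
  \<comment> \<open>Negating weak amalgamation makes every extension \<open>A\<close> of
    \<open>Z\<close> in the class fail as \<open>Z'\<close>, so Eve has a reply whatever Odd plays
    above \<open>Z\<close>.\<close>
  obtain Z where Z: "Z \<in> \<F>" and fails: "\<And>A. A \<in> \<F> \<Longrightarrow> substructure S Z A \<Longrightarrow>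
     \<not> (\<forall>X\<in>\<F>. \<forall>Y\<in>\<F>. \<forall>f g. embedding S f A X \<and> embedding S g A Y \<longrightarrow>
         (\<exists>V\<in>\<F>. \<exists>f' g'. embedding S f' X V \<and> embedding S g' Y V \<and>
           restrict (f' \<circ> f) (carrier Z) = restrict (g' \<circ> g) (carrier Z)))"
    using assms(4) unfolding weak_amalgamation_def by blast
  define E where "E = {restrict h (carrier Z) | h. embedding S h Z W}"
  have E: "countable E"
    unfolding E_def using countable_embeddings str[OF Z] \<open>countable (carrier W)\<close> by blast
  define good where "good A e B \<longleftrightarrow> B \<in> \<F> \<and> substructure S A B \<and>
    \<not> (\<exists>h. embedding S h B W \<and> restrict h (carrier Z) = e)" for A e B
  define move where "move A e = (SOME B. good A e B)" for A e
  \<comment> \<open>Nothing is asked of \<open>e\<close>: \<open>from_nat_into E\<close> has a value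
    at every index even if \<open>E\<close> is finite or empty, and Eve needs a legal move then
    too.\<close>
  have move: "good A e (move A e)" if "A \<in> \<F>" "substructure S Z A" for A e
  proof -
    have "\<exists>B. good A e B"
      unfolding good_def W
      using extension_avoiding_partial_embedding[OF assms(1,3) C that fails[OF that]] by (simp add: Bex_def)
    then show ?thesis
      unfolding move_def by (rule someI_ex)
  qed
  \<comment> \<open>Positions not extending \<open>Z\<close> never occur when Eve follows \<open>s\<close>; repeating the last move is
    legal there.\<close>
  define s where "s p = (if p = [] then Z
    else if substructure S Z (last p) then move (last p) (from_nat_into E (length p div 2 - 1))
    else last p)" for p
  have "eve_strategy S \<F> s"
    unfolding eve_strategy_def
  proof (intro allI impI)
    fix p assume p: "position S \<F> p \<and> even (length p)"
    have "s p \<in> \<F> \<and> (p \<noteq> [] \<longrightarrow> substructure S (last p) (s p))"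
    proof (cases "p = []")
      case True
      then show ?thesis using Z by (simp add: s_def)
    next
      case False
      then have "last p \<in> \<F>"
        using p unfolding position_def by auto
      then show ?thesis
        using False move[unfolded good_def] by (simp add: s_def substructure_refl)
    qed
    then show "position S \<F> (p @ [s p])"
      using p unfolding position_def by (auto simp: successively_append_iff)
  qed
  moreover have "\<not> odd_wins S W A" if A: "chain_in S \<F> A" "eve_follows s A" for A
  proof
    assume "odd_wins S W A"
    then obtain h where h: "embedding S h (chain_union S A) W"
      unfolding odd_wins_def embeds_def by blast
    have mem: "A n \<in> \<F>" for n
      using A(1) unfolding chain_in_def by blast
    have hn: "embedding S h (A n) W" for n
      using embedding_substructure_left[OF substructure_chain_union[OF A(1)] h] str(1) mem by blast
    have "A 0 = Z"
      using A(2) unfolding eve_follows_def by (auto simp: s_def)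
    \<comment> \<open>A winning embedding for Odd, restricted to the opening move, is one of the
      enumerated embeddings, so Eve has treated it in some round \<open>k\<close>.\<close>
    then have "restrict h (carrier Z) \<in> E"
      using hn[of 0] unfolding E_def by blast
    then obtain k where k: "restrict h (carrier Z) = from_nat_into E k"
      using from_nat_into_surj[OF E] by metis
    \<comment> \<open>The position before Eve's move \<open>A (2 * k + 2)\<close>. Her opening
      \<open>Z\<close> treats no embedding, hence the \<open>- 1\<close> in the index.\<close>
    define p where "p = map A [0..<2 * k + 2]"
    have p: "p \<noteq> []" "last p = A (2 * k + 1)" "length p div 2 - 1 = k"
      by (simp_all add: p_def)
    have Zp: "substructure S Z (last p)"
      using chain_substructure_mono[OF A(1), of 0 "2 * k + 1"] \<open>A 0 = Z\<close> p(2) by simp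
    have "A (2 * k + 2) = s p"
      using A(2) unfolding eve_follows_def p_def by simp
    also have "\<dots> = move (last p) (from_nat_into E k)"
      using p Zp by (simp add: s_def)
    finally have "good (last p) (from_nat_into E k) (A (2 * k + 2))"
      using move[OF _ Zp] mem p(2) by simp
    \<comment> \<open>\<open>h\<close> embeds \<open>A (2 * k + 2)\<close> into \<open>W\<close> and
      extends the embedding with index \<open>k\<close>, which this move was chosen to
      exclude.\<close>
    then show False
      using hn[of "2 * k + 2"] k unfolding good_def by blast
  qed
  ultimately show "\<exists>s. eve_winning_strategy S \<F> W s"
    unfolding eve_winning_strategy_def by blast
qed

end
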